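(* Let $\mathcal P=\lambda x.\ \mathsf{aggregate}(f,\mathcal I,\Phi)$ be a program, where $\Phi$ is a data transformation expression with free variable $x$. Then $\mathcal P$ is a dataframe homomorphism if and only if $\mathcal P\hookrightarrow h$ is derivable, by the rules listed in the context, for some binary function $h$. Furthermore, such an $h$ is the merge operator for the homomorphism $\mathcal P$, i.e. $\mathcal P(\mathcal D_1\boxplus\mathcal D_2)=h(\mathcal P(\mathcal D_1),\mathcal P(\mathcal D_2))$ for all dataframes $\mathcal D_1,\mathcal D_2$ on which $\boxplus$ is defined.
   Context: A dataframe is, for fixed columns and column types, a finite (possibly empty) list of rows of a given row type $\tau$. $\mathcal D_1\boxplus\mathcal D_2$ is row concatenation of dataframes with the same columns and column types. $\mathsf{aggregate}(f,\mathcal I,[r_1,\dots,r_n])=f(\dots f(f(\mathcal I,r_1),r_2)\dots,r_n)$, which is $\mathcal I$ on the empty dataframe. Data transformation expressions are given by $\Phi::=x\mid\mathsf{project}(g,\Phi)\mid\mathsf{select}(g,\Phi)$, where $\mathsf{project}(g,\cdot)$ applies the function $g$ to each row and $\mathsf{select}(g,\cdot)$ keeps, in order, the rows satisfying the predicate $g$. $E[e/x]$ is substitution of $e$ for the free variable $x$. A program $\mathcal P$ with values in $\tau_r$ is a dataframe homomorphism if there exists $\oplus:\tau_r\times\tau_r\to\tau_r$ (a merge operator) with $\mathcal P(\mathcal D_1\boxplus\mathcal D_2)=\mathcal P(\mathcal D_1)\oplus\mathcal P(\mathcal D_2)$ for all dataframes on which $\boxplus$ is defined. For $f:\tau_r\times\tau\to\tau_r$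 and $\mathcal I\in\tau_r$, write $\mathsf{Norm}(\tau_r,f,\mathcal I)=h$ if $h:\tau_r\times\tau_r\to\tau_r$ is a normalizer of $f$, i.e. $h(z,f(y,x))=f(h(z,y),x)$ for all $x\in\tau$, $y,z\in\tau_r$, and satisfies $h(s,\mathcal I)=s$ for all $s\in\tau_r$. Rules for the judgment $\hookrightarrow$: (Top) If $\mathcal F[(x_1\boxplus x_2)/x]\hookrightarrow h(\mathcal F[x_1/x],\mathcal F[x_2/x])$, then $\lambda x.\,\mathcal F\hookrightarrow\lambda r_1.\lambda r_2.\,h(r_1,r_2)$. (Agg) If $f:\tau_r\times\tau\to\tau_r$, $\mathsf{Norm}(\tau_r,f,\mathcal I)=h$ and $\Phi\hookrightarrow\Phi_1\boxplus\Phi_2$, then $\mathsf{aggregate}(f,\mathcal I,\Phi)\hookrightarrow h(\mathsf{aggregate}(f,\mathcal I,\Phi_1),\mathsf{aggregate}(f,\mathcal I,\Phi_2))$. (Rel) If $\alpha\in\{\mathsf{project},\mathsf{select}\}$ and $\Phi\hookrightarrow\Phi_1\boxplus\Phi_2$, then $\alpha(g,\Phi)\hookrightarrow\alpha(g,\Phi_1)\boxplus\alpha(g,\Phi_2)$. ($\boxplus$) If $\Phi_1\hookrightarrow\Phi_1'$ and $\Phi_2\hookrightarrow\Phi_2'$, then $\Phi_1\boxplus\Phi_2\hookrightarrow\Phi_1'\boxplus\Phi_2'$. (Var) If $x$ is a variable, then $x\hookrightarrow x$. (Refutation) If $\mathcal P(\mathcal D_1)=\mathcal P(\mathcal D_1')$,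 $\mathcal P(\mathcal D_2)=\mathcal P(\mathcal D_2')$ and $\mathcal P(\mathcal D_1\boxplus\mathcal D_2)\ne\mathcal P(\mathcal D_1'\boxplus\mathcal D_2')$ for some dataframes, then $\mathcal P\hookrightarrow\bot$ (where $\bot$ is a special symbol, not a binary function).
   Formalization: With the types of f fixed, a homomorphism may have no normalizer because of unreachable states or rows; here rule (Agg) may use any sets τ_r, τ (possibly smaller than the program's) at which aggregate(f,I,Φ) is well typed, the row type of Φ being the rows it can actually produce. *)

theory Defs
  imports Main "HOL-Library.FuncSet"
begin

text \<open>
  Projections change the row type, so rows of all types live in one universe \<open>'v\<close> (and aggregation
  results in \<open>'r\<close>), and the types of the calculus are sets of values. A typing such as
  \<open>f : tau_r \<times> tau \<rightarrow> tau_r\<close> is membership in a function space, binary functions being curried.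
  The row type \<open>sigma\<close> of the input dataframes is fixed; all dataframe variables range over
  \<open>lists sigma\<close>, on which concatenation of dataframes is always defined.
\<close>

type_synonym var = nat

datatype 'v dfexp =
    Var var
  | Project "'v \<Rightarrow> 'v" "'v dfexp"
  | Select "'v \<Rightarrow> bool" "'v dfexp"
  | Concat "'v dfexp" "'v dfexp"  (infixr "@@" 65)

datatype ('v, 'r) aggexp =
    Aggregate "'r \<Rightarrow> 'v \<Rightarrow> 'r" 'r "'v dfexp"
  | App "'r \<Rightarrow> 'r \<Rightarrow> 'r" "('v, 'r) aggexp" "('v, 'r) aggexp"

datatype ('v, 'r) program = Lam var "('v, 'r) aggexp"

text \<open>The data transformation expressions with free variable \<open>x\<close>; concatenation only arises during a
  derivation.\<close>

inductive transformation :: "var \<Rightarrow> 'v dfexp \<Rightarrow> bool" for x where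
  "transformation x (Var x)"
| "transformation x \<Phi> \<Longrightarrow> transformation x (Project g \<Phi>)"
| "transformation x \<Phi> \<Longrightarrow> transformation x (Select p \<Phi>)"

fun df_vars :: "'v dfexp \<Rightarrow> var set" where
  "df_vars (Var y) = {y}"
| "df_vars (Project g \<Phi>) = df_vars \<Phi>"
| "df_vars (Select p \<Phi>) = df_vars \<Phi>"
| "df_vars (\<Phi>1 @@ \<Phi>2) = df_vars \<Phi>1 \<union> df_vars \<Phi>2"

fun agg_vars :: "('v, 'r) aggexp \<Rightarrow> var set" where
  "agg_vars (Aggregate f i \<Phi>) = df_vars \<Phi>"
| "agg_vars (App h t1 t2) = agg_vars t1 \<union> agg_vars t2"

fun df_subst :: "'v dfexp \<Rightarrow> var \<Rightarrow> 'v dfexp \<Rightarrow> 'v dfexp" where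
  "df_subst e x (Var y) = (if y = x then e else Var y)"
| "df_subst e x (Project g \<Phi>) = Project g (df_subst e x \<Phi>)"
| "df_subst e x (Select p \<Phi>) = Select p (df_subst e x \<Phi>)"
| "df_subst e x (\<Phi>1 @@ \<Phi>2) = df_subst e x \<Phi>1 @@ df_subst e x \<Phi>2"

fun agg_subst :: "'v dfexp \<Rightarrow> var \<Rightarrow> ('v, 'r) aggexp \<Rightarrow> ('v, 'r) aggexp" where
  "agg_subst e x (Aggregate f i \<Phi>) = Aggregate f i (df_subst e x \<Phi>)"
| "agg_subst e x (App h t1 t2) = App h (agg_subst e x t1) (agg_subst e x t2)"

fun df_eval :: "(var \<Rightarrow> 'v list) \<Rightarrow> 'v dfexp \<Rightarrow> 'v list" where
  "df_eval \<rho> (Var y) = \<rho> y"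
| "df_eval \<rho> (Project g \<Phi>) = map g (df_eval \<rho> \<Phi>)"
| "df_eval \<rho> (Select p \<Phi>) = filter p (df_eval \<rho> \<Phi>)"
| "df_eval \<rho> (\<Phi>1 @@ \<Phi>2) = df_eval \<rho> \<Phi>1 @ df_eval \<rho> \<Phi>2"

fun agg_eval :: "(var \<Rightarrow> 'v list) \<Rightarrow> ('v, 'r) aggexp \<Rightarrow> 'r" where
  "agg_eval \<rho> (Aggregate f i \<Phi>) = foldl f i (df_eval \<rho> \<Phi>)"
| "agg_eval \<rho> (App h t1 t2) = h (agg_eval \<rho> t1) (agg_eval \<rho> t2)"

text \<open>Programs are closed, so the values of the variables other than the bound one are
  immaterial.\<close>

fun run :: "('v, 'r) program \<Rightarrow> 'v list \<Rightarrow> 'r" where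
  "run (Lam x F) D = agg_eval ((\<lambda>_. [])(x := D)) F"

text \<open>An expression has row type \<open>tau\<close> if it always denotes a dataframe with rows in \<open>tau\<close>.\<close>

definition has_row_type :: "'v set \<Rightarrow> 'v dfexp \<Rightarrow> 'v set \<Rightarrow> bool" where
  "has_row_type sigma \<Phi> tau \<longleftrightarrow>
     (\<forall>\<rho>. (\<forall>y. \<rho> y \<in> lists sigma) \<longrightarrow> df_eval \<rho> \<Phi> \<in> lists tau)"

definition homomorphism :: "'v set \<Rightarrow> 'r set \<Rightarrow> ('v, 'r) program \<Rightarrow> bool" where
  "homomorphism sigma tau_r P \<longleftrightarrow>
     (\<exists>m \<in> tau_r \<rightarrow> tau_r \<rightarrow> tau_r. \<forall>D1 \<in> lists sigma. \<forall>D2 \<in> lists sigma.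
        run P (D1 @ D2) = m (run P D1) (run P D2))"

definition normalizer ::
    "'r set \<Rightarrow> 'v set \<Rightarrow> ('r \<Rightarrow> 'v \<Rightarrow> 'r) \<Rightarrow> ('r \<Rightarrow> 'r \<Rightarrow> 'r) \<Rightarrow> bool" where
  "normalizer tau_r tau f h \<longleftrightarrow>
     h \<in> tau_r \<rightarrow> tau_r \<rightarrow> tau_r \<and>
     (\<forall>x\<in>tau. \<forall>y\<in>tau_r. \<forall>z\<in>tau_r. h z (f y x) = f (h z y) x)"

definition Norm ::
    "'r set \<Rightarrow> 'v set \<Rightarrow> ('r \<Rightarrow> 'v \<Rightarrow> 'r) \<Rightarrow> 'r \<Rightarrow> ('r \<Rightarrow> 'r \<Rightarrow> 'r) \<Rightarrow> bool" where
  "Norm tau_r tau f i h \<longleftrightarrow> normalizer tau_r tau f h \<and> (\<forall>s\<in>tau_r. h s i = s)"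

text \<open>The judgment, by the syntactic sort of its subject: dataframe expressions, aggregations, and
  programs. The latter evaluate either to a binary function or to the symbol \<open>\<bottom>\<close>.\<close>

inductive df_step :: "'v dfexp \<Rightarrow> 'v dfexp \<Rightarrow> bool" where
  Var: "df_step (Var y) (Var y)"
| Concat: "\<lbrakk>df_step \<Phi>1 \<Phi>1'; df_step \<Phi>2 \<Phi>2'\<rbrakk> \<Longrightarrow> df_step (\<Phi>1 @@ \<Phi>2) (\<Phi>1' @@ \<Phi>2')"
| Rel_project: "df_step \<Phi> (\<Phi>1 @@ \<Phi>2) \<Longrightarrow>
    df_step (Project g \<Phi>) (Project g \<Phi>1 @@ Project g \<Phi>2)"
| Rel_select: "df_step \<Phi> (\<Phi>1 @@ \<Phi>2) \<Longrightarrow>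
    df_step (Select p \<Phi>) (Select p \<Phi>1 @@ Select p \<Phi>2)"

text \<open>The types \<open>tau_r\<close> and \<open>tau\<close> are metavariables of the rule, which applies at all types that
  make its subject well typed; the first three premises express that typing. These types may be
  smaller than the ones at which a program was introduced, for instance just the states and rows
  that can occur. If they had to agree, a homomorphism with a badly behaved \<open>f\<close> on unreachable
  states would have no derivation.\<close>

inductive agg_step :: "'v set \<Rightarrow> ('v, 'r) aggexp \<Rightarrow> ('v, 'r) aggexp \<Rightarrow> bool" for sigma where
  Agg: "\<lbrakk>f \<in> tau_r \<rightarrow> tau \<rightarrow> tau_r; i \<in> tau_r; has_row_type sigma \<Phi> tau;
      Norm tau_r tau f i h; df_step \<Phi> (\<Phi>1 @@ \<Phi>2)\<rbrakk> \<Longrightarrow>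
    agg_step sigma (Aggregate f i \<Phi>) (App h (Aggregate f i \<Phi>1) (Aggregate f i \<Phi>2))"

datatype 'r outcome = Function "'r \<Rightarrow> 'r \<Rightarrow> 'r" | Bottom

inductive prog_step :: "'v set \<Rightarrow> ('v, 'r) program \<Rightarrow> 'r outcome \<Rightarrow> bool" for sigma where
  Top: "\<lbrakk>x1 \<noteq> x2; x1 \<notin> agg_vars F; x2 \<notin> agg_vars F;
      agg_step sigma (agg_subst (Var x1 @@ Var x2) x F)
        (App h (agg_subst (Var x1) x F) (agg_subst (Var x2) x F))\<rbrakk> \<Longrightarrow>
    prog_step sigma (Lam x F) (Function (\<lambda>r1 r2. h r1 r2))"
| Refutation: "\<lbrakk>D1 \<in> lists sigma; D1' \<in> lists sigma; D2 \<in> lists sigma; D2' \<in> lists sigma;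
      run P D1 = run P D1'; run P D2 = run P D2'; run P (D1 @ D2) \<noteq> run P (D1' @ D2')\<rbrakk> \<Longrightarrow>
    prog_step sigma P Bottom"

end

theory Submission
  imports Defs
begin

text \<open>
  The denotation \<open>T\<close> of a data transformation expression is a monoid homomorphism on lists that sends
  each single row to at most one row. If the program \<open>P\<close> is a homomorphism with merge operator \<open>m\<close>,
  restrict the state type to the values of \<open>P\<close> and the row type to the rows produced by \<open>T\<close>. Every
  such row is \<open>T [d]\<close> for an input row \<open>d\<close>, so applying \<open>f\<close> to it amounts to appending \<open>d\<close> to the
  input; hence \<open>m\<close> normalizes \<open>f\<close> at these types, with \<open>m s i = s\<close> because \<open>i = P []\<close>. Conversely, a
  normalizer \<open>h\<close> commutes with folding \<open>f\<close>, and \<open>h s i = s\<close> starts the fold.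
\<close>

lemma df_eval_subst: "df_eval \<rho> (df_subst e x \<Phi>) = df_eval (\<rho>(x := df_eval \<rho> e)) \<Phi>"
  by (induction \<Phi>) auto

lemma df_eval_cong: "(\<And>y. y \<in> df_vars \<Phi> \<Longrightarrow> \<rho> y = \<rho>' y) \<Longrightarrow> df_eval \<rho> \<Phi> = df_eval \<rho>' \<Phi>"
  by (induction \<Phi>) auto

lemma df_vars_transformation: "transformation x \<Phi> \<Longrightarrow> df_vars \<Phi> = {x}"
  by (induction rule: transformation.induct) auto

lemma df_eval_transformation_cong:
  assumes "transformation x \<Phi>" "\<rho> x = \<rho>' x"
  shows "df_eval \<rho> \<Phi> = df_eval \<rho>' \<Phi>"
  using assms by (intro df_eval_cong) (simp add: df_vars_transformation)

lemma df_eval_transformation_append: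
  "transformation x \<Phi> \<Longrightarrow>
    df_eval (\<rho>(x := D1 @ D2)) \<Phi> = df_eval (\<rho>(x := D1)) \<Phi> @ df_eval (\<rho>(x := D2)) \<Phi>"
  by (induction rule: transformation.induct) auto

lemma df_eval_transformation_Nil: "transformation x \<Phi> \<Longrightarrow> df_eval (\<rho>(x := [])) \<Phi> = []"
  by (induction rule: transformation.induct) auto

lemma df_eval_transformation_single:
  "transformation x \<Phi> \<Longrightarrow> length (df_eval (\<rho>(x := [d])) \<Phi>) \<le> 1"
  by (induction rule: transformation.induct) (auto intro: order_trans[OF length_filter_le])

lemma list_hom_rows:
  assumes "T [] = []" "\<And>d D. T (d # D) = T [d] @ T D" "\<And>d. length (T [d]) \<le> 1"
    and "D \<in> lists S"
  shows "T D \<in> lists {y. \<exists>d\<in>S. T [d] = [y]}"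
  using assms(4)
proof (induction D rule: list.induct)
  case Nil
  then show ?case by (simp add: assms(1))
next
  case (Cons d D)
  have "T [d] \<in> lists {y. \<exists>d\<in>S. T [d] = [y]}"
    using assms(3)[of d] Cons.prems by (cases "T [d]") auto
  then show ?case
    using Cons by (simp add: assms(2)[of d D])
qed

lemma df_eval_transformation_rows:
  assumes "transformation x \<Phi>" "D \<in> lists sigma"
  shows "df_eval (\<rho>(x := D)) \<Phi> \<in> lists {y. \<exists>d\<in>sigma. df_eval (\<rho>(x := [d])) \<Phi> = [y]}"
proof (rule list_hom_rows[where T = "\<lambda>D. df_eval (\<rho>(x := D)) \<Phi>"])
  show "df_eval (\<rho>(x := d # D)) \<Phi> = df_eval (\<rho>(x := [d])) \<Phi> @ df_eval (\<rho>(x := D)) \<Phi>" for d D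
    using df_eval_transformation_append[OF assms(1), of \<rho> "[d]" D] by simp
qed (use assms in \<open>simp_all only: df_eval_transformation_Nil df_eval_transformation_single\<close>)

lemma df_step_transformation:
  "transformation x \<Phi> \<Longrightarrow>
    df_step (df_subst (Var x1 @@ Var x2) x \<Phi>) (df_subst (Var x1) x \<Phi> @@ df_subst (Var x2) x \<Phi>)"
  by (induction rule: transformation.induct) (auto intro: df_step.intros)

lemma foldl_in_type:
  assumes "f \<in> A \<rightarrow> B \<rightarrow> A" "i \<in> A" "ys \<in> lists B"
  shows "foldl f i ys \<in> A"
  using assms(3,2)
proof (induction ys arbitrary: i)
  case (Cons y ys)
  have "f i y \<in> A"
    using assms(1) Cons.hyps(1) Cons.prems by (auto simp: Pi_iff)
  then show ?case using Cons.IH by simp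
qed simp

lemma normalizer_foldl:
  assumes "normalizer A B f h" "f \<in> A \<rightarrow> B \<rightarrow> A" "y \<in> A" "z \<in> A" "ys \<in> lists B"
  shows "h z (foldl f y ys) = foldl f (h z y) ys"
  using assms(5,3)
proof (induction ys arbitrary: y)
  case (Cons a ys)
  have "f y a \<in> A"
    using assms(2) Cons.hyps(1) Cons.prems by (auto simp: Pi_iff)
  then show ?case
    using Cons.IH[of "f y a"] Cons.hyps(1) Cons.prems assms(1,4) by (auto simp: normalizer_def)
qed simp

lemma Norm_foldl_append:
  assumes "Norm A B f i h" "f \<in> A \<rightarrow> B \<rightarrow> A" "i \<in> A" "xs \<in> lists B" "ys \<in> lists B"
  shows "foldl f i (xs @ ys) = h (foldl f i xs) (foldl f i ys)"
  using assms normalizer_foldl[of A B f h i "foldl f i xs" ys] foldl_in_type[of f A B i xs]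
  by (auto simp: Norm_def)

lemma run_aggregate_append:
  assumes "transformation x \<Phi>" "prog_step sigma (Lam x (Aggregate f i \<Phi>)) (Function h)"
    and "D1 \<in> lists sigma" "D2 \<in> lists sigma"
  shows "run (Lam x (Aggregate f i \<Phi>)) (D1 @ D2) =
    h (run (Lam x (Aggregate f i \<Phi>)) D1) (run (Lam x (Aggregate f i \<Phi>)) D2)"
proof -
  let ?T = "\<lambda>D. df_eval ((\<lambda>_. [])(x := D)) \<Phi>"
  from assms(2) obtain x1 x2 A B where x12: "x1 \<noteq> x2"
    and f: "f \<in> A \<rightarrow> B \<rightarrow> A" and i: "i \<in> A" and N: "Norm A B f i h"
    and B: "has_row_type sigma (df_subst (Var x1 @@ Var x2) x \<Phi>) B"
    by (auto elim!: prog_step.cases agg_step.cases)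
  let ?\<rho> = "(\<lambda>_. [])(x1 := D1, x2 := D2)"
  have "\<forall>y. ?\<rho> y \<in> lists sigma"
    using assms(3,4) by simp
  then have "df_eval ?\<rho> (df_subst (Var x1 @@ Var x2) x \<Phi>) \<in> lists B"
    using B unfolding has_row_type_def by blast
  also have "df_eval ?\<rho> (df_subst (Var x1 @@ Var x2) x \<Phi>) = ?T (D1 @ D2)"
    using x12 by (simp add: df_eval_subst)
      (rule df_eval_transformation_cong[OF assms(1)], simp)
  finally have "?T D1 @ ?T D2 \<in> lists B"
    by (simp only: df_eval_transformation_append[OF assms(1)])
  then show ?thesis
    using Norm_foldl_append[OF N f i, of "?T D1" "?T D2"]
    by (simp add: df_eval_transformation_append[OF assms(1)] del: foldl_append)
qed

lemma prog_step_of_homomorphism: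
  assumes "transformation x \<Phi>"
    and m: "\<And>D1 D2. D1 \<in> lists sigma \<Longrightarrow> D2 \<in> lists sigma \<Longrightarrow>
      run (Lam x (Aggregate f i \<Phi>)) (D1 @ D2) =
      m (run (Lam x (Aggregate f i \<Phi>)) D1) (run (Lam x (Aggregate f i \<Phi>)) D2)"
  shows "prog_step sigma (Lam x (Aggregate f i \<Phi>)) (Function m)"
proof -
  let ?T = "\<lambda>D. df_eval ((\<lambda>_. [])(x := D)) \<Phi>"
  let ?R = "\<lambda>D. foldl f i (?T D)"
  define A where "A = ?R ` lists sigma"
  define B where "B = {y. \<exists>d\<in>sigma. ?T [d] = [y]}"
  define x1 x2 where "x1 = Suc x" and "x2 = Suc (Suc x)"
  have merge: "?R (D1 @ D2) = m (?R D1) (?R D2)" if "D1 \<in> lists sigma" "D2 \<in> lists sigma" for D1 D2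
    using m[OF that] by simp
  have R_in: "?R D \<in> A" if "D \<in> lists sigma" for D
    unfolding A_def using that by blast
  have R_step: "f (?R D) y = ?R (D @ [d])" if "?T [d] = [y]" for D d y
    using that by (simp add: df_eval_transformation_append[OF assms(1)])
  have i: "?R [] = i"
    by (simp add: df_eval_transformation_Nil[OF assms(1)])
  have f_type: "f \<in> A \<rightarrow> B \<rightarrow> A"
  proof (intro Pi_I)
    fix s y assume "s \<in> A" "y \<in> B"
    then obtain D d where "D \<in> lists sigma" "s = ?R D" "d \<in> sigma" "?T [d] = [y]"
      unfolding A_def B_def by blast
    then show "f s y \<in> A" using R_step[of d y D] R_in[of "D @ [d]"] by simp
  qed
  have i_in: "i \<in> A"
    using R_in[of "[]"] i by simp
  have row_type: "has_row_type sigma (df_subst (Var x1 @@ Var x2) x \<Phi>) B"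
    unfolding has_row_type_def
  proof (intro allI impI)
    fix \<rho> :: "var \<Rightarrow> 'a list" assume \<rho>: "\<forall>y. \<rho> y \<in> lists sigma"
    have "df_eval \<rho> (df_subst (Var x1 @@ Var x2) x \<Phi>) = ?T (\<rho> x1 @ \<rho> x2)"
      by (simp add: df_eval_subst) (rule df_eval_transformation_cong[OF assms(1)], simp)
    also have "\<dots> \<in> lists B"
      unfolding B_def using \<rho> by (intro df_eval_transformation_rows[OF assms(1)]) simp
    finally show "df_eval \<rho> (df_subst (Var x1 @@ Var x2) x \<Phi>) \<in> lists B" .
  qed
  have m_type: "m \<in> A \<rightarrow> A \<rightarrow> A"
  proof (intro Pi_I)
    fix s t assume "s \<in> A" "t \<in> A"
    then obtain D1 D2 where "D1 \<in> lists sigma" "D2 \<in> lists sigma" "s = ?R D1" "t = ?R D2"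
      unfolding A_def by blast
    then show "m s t \<in> A" using merge[of D1 D2] R_in[of "D1 @ D2"] by simp
  qed
  have m_f: "m z (f y v) = f (m z y) v" if "v \<in> B" "y \<in> A" "z \<in> A" for v y z
  proof -
    obtain d where d: "d \<in> sigma" "?T [d] = [v]"
      using \<open>v \<in> B\<close> unfolding B_def by blast
    obtain D1 D2 where D: "D1 \<in> lists sigma" "D2 \<in> lists sigma" "z = ?R D1" "y = ?R D2"
      using \<open>y \<in> A\<close> \<open>z \<in> A\<close> unfolding A_def by blast
    have "m z (f y v) = m (?R D1) (?R (D2 @ [d]))"
      unfolding D(3,4) R_step[OF d(2)] ..
    also have "\<dots> = ?R (D1 @ D2 @ [d])"
      using merge[of D1 "D2 @ [d]"] d(1) D by simp
    also have "\<dots> = f (?R (D1 @ D2)) v"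
      using R_step[OF d(2), of "D1 @ D2"] by simp
    also have "\<dots> = f (m z y) v"
      unfolding D(3,4) merge[OF D(1,2)] ..
    finally show ?thesis .
  qed
  have m_i: "m s i = s" if "s \<in> A" for s
  proof -
    obtain D where D: "D \<in> lists sigma" "s = ?R D"
      using \<open>s \<in> A\<close> unfolding A_def by blast
    have "m s i = m (?R D) (?R [])"
      unfolding D(2) i ..
    also have "\<dots> = ?R D"
      using merge[OF D(1), of "[]"] by simp
    finally show ?thesis unfolding D(2) .
  qed
  have "Norm A B f i m"
    unfolding Norm_def normalizer_def by (intro conjI ballI m_type m_f m_i)
  from agg_step.Agg[OF f_type i_in row_type this df_step_transformation[OF assms(1)]]
  have step: "agg_step sigma (agg_subst (Var x1 @@ Var x2) x (Aggregate f i \<Phi>))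
      (App m (agg_subst (Var x1) x (Aggregate f i \<Phi>)) (agg_subst (Var x2) x (Aggregate f i \<Phi>)))"
    by simp
  have "x1 \<noteq> x2" "x1 \<notin> agg_vars (Aggregate f i \<Phi>)" "x2 \<notin> agg_vars (Aggregate f i \<Phi>)"
    by (simp_all add: x1_def x2_def df_vars_transformation[OF assms(1)])
  from prog_step.Top[OF this step] show ?thesis .
qed

text \<open>A derivable function is only known to be well typed on the types chosen in its derivation, so
  the merge operator is made total on \<open>tau_r\<close> by a default value outside the range of the
  program.\<close>

lemma homomorphism_of_merge:
  assumes "\<And>D. D \<in> lists sigma \<Longrightarrow> run P D \<in> tau_r"
    and "\<And>D1 D2. D1 \<in> lists sigma \<Longrightarrow> D2 \<in> lists sigma \<Longrightarrow> run P (D1 @ D2) = h (run P D1) (run P D2)"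
  shows "homomorphism sigma tau_r P"
proof -
  let ?R = "run P ` lists sigma"
  define m where "m r s = (if r \<in> ?R \<and> s \<in> ?R then h r s else run P [])" for r s
  have "m r s \<in> tau_r" for r s
  proof (cases "r \<in> ?R \<and> s \<in> ?R")
    case True
    then obtain D1 D2 where "D1 \<in> lists sigma" "D2 \<in> lists sigma" "r = run P D1" "s = run P D2"
      by blast
    then show ?thesis
      using True assms(1)[of "D1 @ D2"] assms(2)[of D1 D2] by (simp add: m_def)
  next
    case False
    then have "m r s = run P []" unfolding m_def by (rule if_not_P)
    then show ?thesis using assms(1)[of "[]"] by simp
  qed
  moreover have "run P (D1 @ D2) = m (run P D1) (run P D2)"
    if "D1 \<in> lists sigma" "D2 \<in> lists sigma" for D1 D2
    using assms(2)[OF that] that by (simp add: m_def)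
  ultimately show ?thesis
    unfolding homomorphism_def by (intro bexI[of _ m]) auto
qed

theorem theorem4p11:
  fixes sigma tau :: "'v set" and tau_r :: "'r set"
    and f :: "'r \<Rightarrow> 'v \<Rightarrow> 'r" and i :: 'r
    and \<Phi> :: "'v dfexp" and x :: var and P :: "('v, 'r) program"
  assumes "transformation x \<Phi>"
    and "has_row_type sigma \<Phi> tau"
    and "f \<in> tau_r \<rightarrow> tau \<rightarrow> tau_r"
    and "i \<in> tau_r"
    and "P = Lam x (Aggregate f i \<Phi>)"
  shows "(homomorphism sigma tau_r P \<longleftrightarrow> (\<exists>h. prog_step sigma P (Function h))) \<and>
    (\<forall>h. prog_step sigma P (Function h) \<longrightarrow>
      (\<forall>D1 \<in> lists sigma. \<forall>D2 \<in> lists sigma.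
        run P (D1 @ D2) = h (run P D1) (run P D2)))"
proof -
  have merge: "run P (D1 @ D2) = h (run P D1) (run P D2)"
    if "prog_step sigma P (Function h)" "D1 \<in> lists sigma" "D2 \<in> lists sigma" for h D1 D2
    using that unfolding assms(5) by (rule run_aggregate_append[OF assms(1)])
  have typed: "run P D \<in> tau_r" if "D \<in> lists sigma" for D
  proof -
    have "\<forall>y. ((\<lambda>_. [])(x := D)) y \<in> lists sigma"
      using that by simp
    then have "df_eval ((\<lambda>_. [])(x := D)) \<Phi> \<in> lists tau"
      using assms(2) unfolding has_row_type_def by blast
    then show ?thesis
      unfolding assms(5) using foldl_in_type[OF assms(3,4)] by simp
  qed
  have "\<exists>h. prog_step sigma P (Function h)" if hom: "homomorphism sigma tau_r P"
  proof -
    obtain m where "\<forall>D1\<in>lists sigma. \<forall>D2\<in>lists sigma. run P (D1 @ D2) = m (run P D1) (run P D2)"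
      using hom unfolding homomorphism_def by blast
    then have "prog_step sigma P (Function m)"
      unfolding assms(5) by (intro prog_step_of_homomorphism[OF assms(1)]) blast
    then show ?thesis by blast
  qed
  moreover have "homomorphism sigma tau_r P" if "prog_step sigma P (Function h)" for h
    using homomorphism_of_merge typed merge[OF that] by blast
  ultimately show ?thesis
    using merge by blast
qed

end
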